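(* (Known objective, inner domain approximation.) Let $\mu,\alpha>0$, let $f$ be $\mu$-strongly convex on $D$, let $D$ be $\alpha$-strongly convex, let $x^\star$ be the unique minimizer of $f$ on $D$, and assume $x^\star\in\operatorname{relint}(D)$. Assume that the curvature constant $$C_f=\sup\Big\{\tfrac{2}{\lambda^2}\big(f(x+\lambda(s-x))-f(x)-\lambda\langle s-x\mid\nabla f(x)\rangle\big): x,s\in D,\ \lambda\in(0,1]\Big\}$$ is finite, and let $L_f=\max\{\lVert\nabla f(x)\rVert:x\in D\}$. Let $\mathbf{X}=(\mathbf{X}_n)_{n\in\mathbb{N}}$ be the iterate process generated by the recursive adaptive stochastic Frank–Wolfe algorithm with known objective function $f$ (defined in the context), starting random variable $\mathbf{X}_0$ and domain approximation process $\mathbf{D}$. Let $\beta_1,\delta\in[0,1]$, $r_1\in(0,1]$, $c_1>0$ and $\eta_1\ge0$ with $3\eta_1<h(x^\star,\operatorname{relbd}(D))$ be such that (i) $\mathbb{P}\big[d_H(\mathbf{D}_{n+1},D)\le c_1\lambda_n^{r_1}+\eta_1\text{ for all }n\in\mathbb{N}\big]\ge1-\beta_1$; (ii) $\mathbb{P}\big[\bigcup_{n\in\mathbb{N}}\mathbf{D}_n\subseteq D\big]\ge1-\delta$. Then, denoting $\pi=\mathbb{P}[\nabla f(\mathbf{X}_n)=0\text{ for some }n\in\mathbb{N}]$, there exist $N\in\mathbb{N}$ and $B\ge0$ such that $$\mathbb{P}\Big[0\le f(\mathbf{X}_n)-P^\star\le B\lambda_{n-1}^{2r_1}+\tfrac32\eta_1L_f\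 \text{ for all }n\ge N\Big]\ge1-(\beta_1+\delta+\pi).$$
   Context: $\mathbb{N}=\{1,2,\dots\}$, $\mathbb{N}_0=\mathbb{N}\cup\{0\}$. $H$ is a finite-dimensional real Hilbert space with inner product $\langle\cdot\mid\cdot\rangle$ and induced norm $\lVert\cdot\rVert$; $h(x,Y)=\inf\{\lVert x-y\rVert:y\in Y\}$. $f:\operatorname{dom}(f)\to\mathbb{R}$ is convex and continuously differentiable, with $\operatorname{dom}(f)\subseteq H$ closed; $D\subseteq\operatorname{dom}(f)$ is nonempty, compact and convex; $P^\star=\min_{x\in D}f(x)$. $\operatorname{relint}$ and $\operatorname{relbd}$ denote relative interior and relative boundary. $(\Omega,\Sigma,\mathbb{P})$ is a complete probability space. $\lambda_n=2/(n+2)$ for $n\in\mathbb{N}_0$. $f$ is $\mu$-strongly convex on $D$ if $f(x)\ge f(y)+\langle x-y\mid\nabla f(y)\rangle+\frac{\mu}{2}\lVert x-y\rVert^2$ for all $x,y\in D$. A set $K\subseteq H$ is $\alpha$-strongly convex if $\lambda x+(1-\lambda)y+\lambda(1-\lambda)\frac{\alpha}{2}\lVert x-y\rVert^2z\in K$ for all $x,y\in K$, $\lambda\in[0,1]$ and $z\in H$ with $\lVert z\rVert=1$. $\mathscr{D}$ is the set of nonempty compact convex subsets of $H$ with the Hausdorff metric $d_H(X,Y)=\max\{\sup_{x\in X}h(x,Y),\ \sup_{y\in Y}h(y,X)\}$ and its Borel $\sigma$-algebra. A domain approximation process is a stochastic process $\mathbf{D}:\mathbb{N}\times\Omega\to\mathscr{D}$,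 i.e. each $\mathbf{D}_n:\Omega\to\mathscr{D}$ is measurable. Algorithm with known objective (with extension domain equal to $D$): $\mathbf{X}_0:\Omega\to H$ is measurable with $\mathbf{X}_0\in D$ almost surely. Put $N_0=\{\bigcup_{n\in\mathbb{N}}\mathbf{D}_n\subseteq D\}\cap\{\mathbf{X}_0\in D\}\in\Sigma$. For $n\in\mathbb{N}_0$, $\mathbf{S}_{n+1}:\Omega\to H$ is a measurable selection with $$\mathbf{S}_{n+1}(\omega)\in\operatorname{arg\,min}\{\mathbf{1}_{N_0}(\omega)\langle s\mid\nabla f(\mathbf{X}_n(\omega))\rangle: s\in\mathbf{D}_{n+1}(\omega)\}\quad\text{for all }\omega\in\Omega$$ (the objective is read as $0$ for $\omega\notin N_0$), and $\mathbf{X}_{n+1}=\mathbf{X}_n+\lambda_n(\mathbf{S}_{n+1}-\mathbf{X}_n)$. On $N_0$ all $\mathbf{X}_n$ lie in $D$. The event defining $\pi$ is read as: for some $n\in\mathbb{N}$, $\mathbf{X}_n\in\operatorname{dom}(f)$ and $\nabla f(\mathbf{X}_n)=0$. *)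

theory Defs
  imports "HOL-Probability.Probability"
begin

text \<open>
  A function with domain \<open>S\<close> is a total function that is only looked at on \<open>S\<close>. Differentiability
  is taken within \<open>S\<close>, so that the gradient makes sense at boundary points of \<open>S\<close>. It is
  determined by \<open>f\<close> as soon as the interior of the convex set \<open>S\<close> is nonempty.
\<close>

definition has_continuous_gradient_on ::
    "('a::euclidean_space \<Rightarrow> real) \<Rightarrow> ('a \<Rightarrow> 'a) \<Rightarrow> 'a set \<Rightarrow> bool" where
  "has_continuous_gradient_on f g S \<longleftrightarrow>
     (\<forall>x\<in>S. (f has_derivative (\<lambda>v. v \<bullet> g x)) (at x within S)) \<and> continuous_on S g"

definition strongly_convex_fun_on ::
    "real \<Rightarrow> 'a::euclidean_space set \<Rightarrow> ('a \<Rightarrow> real) \<Rightarrow> ('a \<Rightarrow> 'a) \<Rightarrow> bool" where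
  "strongly_convex_fun_on \<mu> D f g \<longleftrightarrow>
     (\<forall>x\<in>D. \<forall>y\<in>D. f x \<ge> f y + (x - y) \<bullet> g y + \<mu> / 2 * (norm (x - y))\<^sup>2)"

definition strongly_convex_set :: "real \<Rightarrow> 'a::euclidean_space set \<Rightarrow> bool" where
  "strongly_convex_set \<alpha> K \<longleftrightarrow>
     (\<forall>x\<in>K. \<forall>y\<in>K. \<forall>l\<in>{0..1}. \<forall>z. norm z = 1 \<longrightarrow>
        l *\<^sub>R x + (1 - l) *\<^sub>R y + (l * (1 - l) * (\<alpha> / 2) * (norm (x - y))\<^sup>2) *\<^sub>R z \<in> K)"

definition curvature_constant ::
    "('a::euclidean_space \<Rightarrow> real) \<Rightarrow> ('a \<Rightarrow> 'a) \<Rightarrow> 'a set \<Rightarrow> ereal" where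
  "curvature_constant f g D =
     Sup {ereal (2 / l\<^sup>2 * (f (x + l *\<^sub>R (s - x)) - f x - l * ((s - x) \<bullet> g x))) | x s l.
            x \<in> D \<and> s \<in> D \<and> 0 < l \<and> l \<le> 1}"

text \<open>The supremum and the infimum below are attained when \<open>D\<close> is nonempty and compact and
  \<open>g\<close> and \<open>f\<close> are continuous on \<open>D\<close>.\<close>

definition max_gradient_norm :: "('a::euclidean_space \<Rightarrow> 'a) \<Rightarrow> 'a set \<Rightarrow> real" where
  "max_gradient_norm g D = (SUP x\<in>D. norm (g x))"

definition min_value :: "('a::euclidean_space \<Rightarrow> real) \<Rightarrow> 'a set \<Rightarrow> real" where
  "min_value f D = (INF x\<in>D. f x)"


text \<open>
  Extended-real valued, because \<open>point_dist x {} = \<infinity>\<close> is needed: the relative boundary of a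
  singleton is empty, whereas \<^const>\<open>infdist\<close> to the empty set is \<open>0\<close>.
\<close>

definition point_dist :: "'a::euclidean_space \<Rightarrow> 'a set \<Rightarrow> ereal" where
  "point_dist x Y = (INF y\<in>Y. ereal (norm (x - y)))"

lemma point_dist_empty: "point_dist x {} = \<infinity>"
  by (simp add: point_dist_def top_ereal_def)

lemma point_dist_infdist:
  assumes "Y \<noteq> {}"
  shows "point_dist x Y = ereal (infdist x Y)"
proof -
  have "ereal (INF y\<in>Y. dist x y) = Inf (ereal ` dist x ` Y)"
    using assms by (intro ereal_Inf') auto
  then show ?thesis
    using assms by (simp add: point_dist_def infdist_def dist_norm image_image)
qed

definition convex_bodies :: "'a::euclidean_space set set" where
  "convex_bodies = {K. K \<noteq> {} \<and> compact K \<and> convex K}"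

text \<open>Set to \<open>0\<close> off \<^const>\<open>convex_bodies\<close>, since \<^locale>\<open>Metric_space\<close> asks for nonnegativity and
  symmetry of the distance on the whole type.\<close>

definition hausdorff_dist :: "'a::euclidean_space set \<Rightarrow> 'a set \<Rightarrow> real" where
  "hausdorff_dist X Y =
     (if X \<in> convex_bodies \<and> Y \<in> convex_bodies
      then max (SUP x\<in>X. infdist x Y) (SUP y\<in>Y. infdist y X) else 0)"

lemma bdd_above_infdist:
  assumes "X \<in> convex_bodies"
  shows "bdd_above ((\<lambda>x. infdist x Y) ` X)"
proof -
  have "compact ((\<lambda>x. infdist x Y) ` X)"
    using assms by (auto simp: convex_bodies_def intro!: compact_continuous_image continuous_intros)
  then show ?thesis
    by (simp add: bounded_imp_bdd_above compact_imp_bounded)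
qed

lemma infdist_le_hausdorff_dist:
  assumes "X \<in> convex_bodies" "Y \<in> convex_bodies"
  shows "x \<in> X \<Longrightarrow> infdist x Y \<le> hausdorff_dist X Y"
    and "y \<in> Y \<Longrightarrow> infdist y X \<le> hausdorff_dist X Y"
  using assms
  by (auto simp: hausdorff_dist_def le_max_iff_disj intro: cSUP_upper bdd_above_infdist)

lemma hausdorff_dist_le:
  assumes "X \<in> convex_bodies" "Y \<in> convex_bodies"
    and "\<And>x. x \<in> X \<Longrightarrow> infdist x Y \<le> c" "\<And>y. y \<in> Y \<Longrightarrow> infdist y X \<le> c"
  shows "hausdorff_dist X Y \<le> c"
  using assms by (auto simp: hausdorff_dist_def convex_bodies_def intro!: cSUP_least)

lemma infdist_triangle_hausdorff:
  assumes "X \<in> convex_bodies" "Y \<in> convex_bodies" "Z \<in> convex_bodies" "x \<in> X"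
  shows "infdist x Z \<le> hausdorff_dist X Y + hausdorff_dist Y Z"
proof -
  obtain y where y: "y \<in> Y" "infdist x Y = dist x y"
    using assms infdist_attains_inf[of Y x] by (auto simp: convex_bodies_def compact_imp_closed)
  have "infdist x Z \<le> infdist y Z + dist x y"
    by (rule infdist_triangle)
  then show ?thesis
    using infdist_le_hausdorff_dist(1)[OF assms(1,2,4)] infdist_le_hausdorff_dist(1)[OF assms(2,3) y(1)] y
    by simp
qed

lemma hausdorff_dist_commute: "hausdorff_dist X Y = hausdorff_dist Y X"
  by (auto simp: hausdorff_dist_def max.commute)

lemma hausdorff_dist_nonneg: "0 \<le> hausdorff_dist X Y"
proof (cases "X \<in> convex_bodies \<and> Y \<in> convex_bodies")
  case True
  then obtain x where "x \<in> X" by (auto simp: convex_bodies_def)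
  then show ?thesis
    using infdist_le_hausdorff_dist(1)[of X Y x] infdist_nonneg[of x Y] True by linarith
qed (auto simp: hausdorff_dist_def)

interpretation hausdorff: Metric_space convex_bodies hausdorff_dist
proof
  fix X Y Z :: "'a set"
  show "0 \<le> hausdorff_dist X Y" by (rule hausdorff_dist_nonneg)
  show "hausdorff_dist X Y = hausdorff_dist Y X" by (rule hausdorff_dist_commute)
  assume X: "X \<in> convex_bodies" and Y: "Y \<in> convex_bodies"
  show "hausdorff_dist X Y = 0 \<longleftrightarrow> X = Y"
  proof
    assume "hausdorff_dist X Y = 0"
    then have 0: "infdist x Y = 0" if "x \<in> X" for x
      using infdist_le_hausdorff_dist(1)[OF X Y that] infdist_nonneg[of x Y] by simp
    have 1: "infdist y X = 0" if "y \<in> Y" for y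
      using infdist_le_hausdorff_dist(2)[OF X Y that] infdist_nonneg[of y X]
        \<open>hausdorff_dist X Y = 0\<close> by simp
    have "closed X" "X \<noteq> {}" "closed Y" "Y \<noteq> {}"
      using X Y by (simp_all add: convex_bodies_def compact_imp_closed)
    then show "X = Y"
      using 0 1 in_closed_iff_infdist_zero by blast
  next
    assume "X = Y"
    then show "hausdorff_dist X Y = 0"
      using hausdorff_dist_le[OF X Y, of 0] hausdorff_dist_nonneg[of X Y] by simp
  qed
  assume Z: "Z \<in> convex_bodies"
  show "hausdorff_dist X Z \<le> hausdorff_dist X Y + hausdorff_dist Y Z"
    using infdist_triangle_hausdorff[OF X Y Z] infdist_triangle_hausdorff[OF Z Y X]
    by (intro hausdorff_dist_le[OF X Z]) (auto simp: hausdorff_dist_commute add.commute)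
qed

definition hausdorff_borel :: "'a::euclidean_space set measure" where
  "hausdorff_borel = sigma convex_bodies {U. openin hausdorff.mtopology U}"


definition step_size :: "nat \<Rightarrow> real" where
  "step_size n = 2 / (real n + 2)"

text \<open>The index of a domain approximation process starts at \<open>1\<close>; \<open>Dn 0\<close> is unconstrained.\<close>

definition domain_approximation_process ::
    "'w measure \<Rightarrow> (nat \<Rightarrow> 'w \<Rightarrow> 'a::euclidean_space set) \<Rightarrow> bool" where
  "domain_approximation_process M Dn \<longleftrightarrow> (\<forall>n\<ge>1. Dn n \<in> measurable M hausdorff_borel)"

definition inner_approximation_event ::
    "'w measure \<Rightarrow> 'a set \<Rightarrow> (nat \<Rightarrow> 'w \<Rightarrow> 'a::euclidean_space set) \<Rightarrow> 'w set" where
  "inner_approximation_event M D Dn = {\<omega> \<in> space M. (\<Union>n\<in>{1..}. Dn n \<omega>) \<subseteq> D}"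

text \<open>
  The indicator makes the objective of the linear subproblem vanish off \<open>N\<^sub>0\<close>, where the iterates
  may leave \<open>D\<close> and the value of \<open>g\<close> carries no meaning. \<open>S 0\<close> is unconstrained.
\<close>

definition frank_wolfe_known_objective ::
    "'w measure \<Rightarrow> ('a::euclidean_space \<Rightarrow> 'a) \<Rightarrow> 'a set \<Rightarrow> (nat \<Rightarrow> 'w \<Rightarrow> 'a set) \<Rightarrow>
     (nat \<Rightarrow> 'w \<Rightarrow> 'a) \<Rightarrow> (nat \<Rightarrow> 'w \<Rightarrow> 'a) \<Rightarrow> bool" where
  "frank_wolfe_known_objective M g D Dn S X \<longleftrightarrow>
     (let N\<^sub>0 = inner_approximation_event M D Dn \<inter> {\<omega> \<in> space M. X 0 \<omega> \<in> D} in
        domain_approximation_process M Dn \<and>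
        X 0 \<in> borel_measurable M \<and> (AE \<omega> in M. X 0 \<omega> \<in> D) \<and>
        (\<forall>n. S (Suc n) \<in> borel_measurable M) \<and>
        (\<forall>n. \<forall>\<omega>\<in>space M.
           is_arg_min (\<lambda>s. indicator N\<^sub>0 \<omega> * (s \<bullet> g (X n \<omega>))) (\<lambda>s. s \<in> Dn (Suc n) \<omega>)
             (S (Suc n) \<omega>)) \<and>
        (\<forall>n. \<forall>\<omega>\<in>space M.
           X (Suc n) \<omega> = X n \<omega> + step_size n *\<^sub>R (S (Suc n) \<omega> - X n \<omega>)))"

end

theory Submission
  imports Defs "HOL-Real_Asymp.Real_Asymp"
begin

text \<open>
  On the event that the approximation is inner and that (i) holds, the iterates obey a deterministic
  recursion. If \<open>D\<close> is not a singleton, strong convexity makes it full-dimensional, so \<open>D\<close> contains a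
  ball of radius \<open>r > \<eta>1\<close> around \<open>xstar\<close>. Minimising \<open>\<langle>\<cdot> | \<nabla>f(x)\<rangle>\<close> over a set within Hausdorff distance
  \<open>e\<close> of \<open>D\<close> then gains \<open>(r - e) \<parallel>\<nabla>f(x)\<parallel>\<close> over the value at \<open>xstar\<close>, and strong convexity of \<open>f\<close> gives
  \<open>\<parallel>\<nabla>f(x)\<parallel> \<ge> sqrt (2 \<mu> (f(x) - P))\<close>, where \<open>P\<close> is the minimum of \<open>f\<close> on \<open>D\<close>. So
  \<open>h\<^sub>n = f(X\<^sub>n) - P\<close> satisfies
  \<open>h\<^sub>n\<^sub>+\<^sub>1 \<le> (1 - \<lambda>\<^sub>n) h\<^sub>n - \<lambda>\<^sub>n a sqrt h\<^sub>n + \<lambda>\<^sub>n\<^sup>2 C / 2\<close> for all large \<open>n\<close>, with \<open>a > 0\<close>. This forces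
  \<open>h\<^sub>n = O(\<lambda>\<^sub>n\<^sub>-\<^sub>1\<^sup>2)\<close>, which is stronger than the claim since \<open>2 r1 \<le> 2\<close>.
\<close>

section \<open>Step sizes and the scalar recursion\<close>

lemma step_size_bounds: "0 < step_size n" "step_size n \<le> 1"
  by (auto simp: step_size_def)

lemma step_size_tendsto_0: "step_size \<longlonglongrightarrow> 0"
  unfolding step_size_def by real_asymp

text \<open>With \<open>n = k + 1\<close> this reduces to
  \<open>(k + 1) * (k + 3) \<le> (k + 2)^2\<close>. It lets the contraction factor alone carry a
  bound of order \<open>(step_size (n - 1))\<^sup>2\<close> one index further.\<close>

lemma one_minus_step_size_mult_le:
  assumes "n \<ge> 1"
  shows "(1 - step_size n) * (step_size (n - 1))\<^sup>2 \<le> (step_size n)\<^sup>2"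
proof -
  obtain k where n: "n = Suc k"
    using assms by (cases n) auto
  have "1 - step_size n = (real k + 1) / (real k + 3)" "step_size (n - 1) = 2 / (real k + 2)"
    by (simp_all add: n step_size_def field_simps)
  then have "(1 - step_size n) * (step_size (n - 1))\<^sup>2
      = 4 * ((real k + 1) * (real k + 3)) / ((real k + 3)\<^sup>2 * (real k + 2)\<^sup>2)"
    by (simp add: power_divide power2_eq_square)
  also have "\<dots> \<le> 4 * (real k + 2)\<^sup>2 / ((real k + 3)\<^sup>2 * (real k + 2)\<^sup>2)"
    by (intro divide_right_mono mult_left_mono) (auto simp: power2_eq_square algebra_simps)
  also have "\<dots> = (step_size n)\<^sup>2"
    by (simp add: n step_size_def power_divide add.commute)
  finally show ?thesis .
qed

text \<open>The square-root gain balances the curvature term at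
  \<open>sqrt (h n) = step_size n * C / (2 * a)\<close>. At or above this threshold the gain absorbs
  the curvature term, and contraction finishes the induction step. Below it \<open>h n\<close> is
  already of order \<open>(step_size n)\<^sup>2\<close>, so the next value is bounded without the
  induction hypothesis; this case dictates the lower bound on \<open>B\<close>.\<close>

lemma step_size_recursion_bound:
  fixes h :: "nat \<Rightarrow> real"
  assumes "m \<ge> 1" "a > 0" "C \<ge> 0" and nonneg: "\<And>n. n \<ge> m \<Longrightarrow> 0 \<le> h n"
    and step: "\<And>n. n \<ge> m \<Longrightarrow>
      h (Suc n) \<le> (1 - step_size n) * h n - step_size n * a * sqrt (h n) + (step_size n)\<^sup>2 * C / 2"
    and B: "C\<^sup>2 / (4 * a\<^sup>2) + C / 2 \<le> B" and base: "h m \<le> B * (step_size (m - 1))\<^sup>2"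
    and "n \<ge> m"
  shows "h n \<le> B * (step_size (n - 1))\<^sup>2"
  using \<open>n \<ge> m\<close>
proof (induction n rule: dec_induct)
  case (step n)
  let ?l = "step_size n"
  have l: "0 < ?l" "?l \<le> 1"
    by (rule step_size_bounds)+
  have B0: "B \<ge> 0"
    using B \<open>C \<ge> 0\<close> order_trans[of 0 "C\<^sup>2 / (4 * a\<^sup>2) + C / 2" B] by simp
  have hn: "0 \<le> h n"
    using nonneg step by simp
  have "h (Suc n) \<le> B * ?l\<^sup>2"
  proof (cases "?l * C / (2 * a) \<le> sqrt (h n)")
    case True
    then have "?l * (?l * C / 2) \<le> ?l * (a * sqrt (h n))"
      using l \<open>a > 0\<close> by (intro mult_left_mono) (auto simp: field_simps)
    moreover have "(1 - ?l) * h n \<le> (1 - ?l) * (B * (step_size (n - 1))\<^sup>2)"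
      using step.IH l by (intro mult_left_mono) auto
    moreover have "B * ((1 - ?l) * (step_size (n - 1))\<^sup>2) \<le> B * ?l\<^sup>2"
      using one_minus_step_size_mult_le[of n] B0 step.hyps \<open>m \<ge> 1\<close>
      by (intro mult_left_mono) auto
    ultimately show ?thesis
      using assms(5)[of n] step.hyps by (simp add: power2_eq_square mult.assoc mult.left_commute)
  next
    case False
    then have "(sqrt (h n))\<^sup>2 \<le> (?l * C / (2 * a))\<^sup>2"
      using hn by (intro power_mono) auto
    then have "h n \<le> ?l\<^sup>2 * (C\<^sup>2 / (4 * a\<^sup>2))"
      using hn by (simp add: power_divide power_mult_distrib)
    moreover have "(1 - ?l) * h n \<le> h n"
      using l hn by (intro mult_left_le_one_le) auto
    moreover have "0 \<le> ?l * a * sqrt (h n)"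
      using l hn \<open>a > 0\<close> by simp
    ultimately have "h (Suc n) \<le> ?l\<^sup>2 * (C\<^sup>2 / (4 * a\<^sup>2) + C / 2)"
      using assms(5)[of n] step.hyps by (simp add: distrib_left)
    also have "\<dots> \<le> ?l\<^sup>2 * B"
      using B by (intro mult_left_mono) auto
    finally show ?thesis
      by (simp add: mult.commute)
  qed
  then show ?case
    by simp
qed (use base in simp)

section \<open>Estimates for a single step\<close>

text \<open>Moving from \<open>x\<close> to the boundary of the ball in direction \<open>-v\<close>
  gains \<open>r * norm v\<close>. Replacing the point reached by its nearest point in
  \<open>K\<close> loses at most \<open>e * norm v\<close>, and the minimizer over \<open>K\<close>
  does no worse.\<close>

lemma linear_minimum_hausdorff_le:
  fixes D K :: "'a::euclidean_space set"
  assumes "K \<in> convex_bodies" "D \<in> convex_bodies" "hausdorff_dist K D \<le> e"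
    and s: "is_arg_min (\<lambda>s. s \<bullet> v) (\<lambda>s. s \<in> K) s"
    and "cball x r \<subseteq> D" "r \<ge> 0"
  shows "s \<bullet> v \<le> x \<bullet> v - (r - e) * norm v"
proof -
  \<comment> \<open>For \<open>v = 0\<close> this is just \<open>x\<close>, so no case distinction
    arises.\<close>
  define y where "y = x - (r / norm v) *\<^sub>R v"
  have "y \<in> D"
    using assms(5,6) by (auto simp: y_def dist_norm subset_iff)
  obtain y' where y': "y' \<in> K" "infdist y K = dist y y'"
    using assms(1) infdist_attains_inf[of K y] by (auto simp: convex_bodies_def compact_imp_closed)
  have "norm (y' - y) \<le> e"
    using infdist_le_hausdorff_dist(2)[OF assms(1,2) \<open>y \<in> D\<close>] assms(3) y'
    by (simp add: dist_norm norm_minus_commute)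
  then have "(y' - y) \<bullet> v \<le> e * norm v"
    using norm_cauchy_schwarz[of "y' - y" v] mult_right_mono[of "norm (y' - y)" e "norm v"] by simp
  moreover have "s \<bullet> v \<le> y' \<bullet> v"
    using s y'(1) by (auto simp: is_arg_min_linorder)
  moreover have "y \<bullet> v = x \<bullet> v - r * norm v"
    by (simp add: y_def inner_diff_left dot_square_norm power2_eq_square)
  ultimately show ?thesis
    by (simp add: inner_diff_left algebra_simps)
qed

text \<open>The second bound is of Polyak-Lojasiewicz type: after Cauchy-Schwarz the gap is at most
  a concave quadratic in \<open>norm (x - y)\<close>, and completing the square bounds that by
  \<open>(norm (g x))\<^sup>2 / (2 * \<mu>)\<close>.\<close>

lemma strongly_convex_fun_gap_le:
  assumes "strongly_convex_fun_on \<mu> D f g" "x \<in> D" "y \<in> D" "\<mu> > 0"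
  shows "f x - f y \<le> (x - y) \<bullet> g x"
    and "sqrt (2 * \<mu> * (f x - f y)) \<le> norm (g x)"
proof -
  let ?d = "norm (x - y)" and ?G = "norm (g x)"
  have *: "f x - f y \<le> (x - y) \<bullet> g x - \<mu> / 2 * ?d\<^sup>2"
    using assms(1-3) unfolding strongly_convex_fun_on_def
    by (fastforce simp: inner_diff_left norm_minus_commute)
  then show "f x - f y \<le> (x - y) \<bullet> g x"
    using \<open>\<mu> > 0\<close> by (smt (verit) zero_le_power2 mult_nonneg_nonneg divide_nonneg_nonneg)
  have "f x - f y \<le> ?d * ?G - \<mu> / 2 * ?d\<^sup>2"
    using * norm_cauchy_schwarz[of "x - y" "g x"] by simp
  then have "2 * \<mu> * (f x - f y) \<le> 2 * \<mu> * (?d * ?G - \<mu> / 2 * ?d\<^sup>2)"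
    using \<open>\<mu> > 0\<close> by (intro mult_left_mono) auto
  also have "\<dots> = ?G\<^sup>2 - (?G - \<mu> * ?d)\<^sup>2"
    by (simp add: power2_eq_square algebra_simps)
  finally have "2 * \<mu> * (f x - f y) \<le> ?G\<^sup>2"
    by (smt (verit) zero_le_power2)
  then show "sqrt (2 * \<mu> * (f x - f y)) \<le> ?G"
    by (simp add: real_le_lsqrt)
qed

lemma curvature_constant_bound:
  assumes "\<bar>curvature_constant f g D\<bar> \<noteq> \<infinity>" "x \<in> D" "s \<in> D" "0 < l" "l \<le> 1"
  shows "f (x + l *\<^sub>R (s - x))
    \<le> f x + l * ((s - x) \<bullet> g x) + l\<^sup>2 * real_of_ereal (curvature_constant f g D) / 2"
proof -
  let ?C = "real_of_ereal (curvature_constant f g D)"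
    and ?q = "f (x + l *\<^sub>R (s - x)) - f x - l * ((s - x) \<bullet> g x)"
  have "ereal (2 / l\<^sup>2 * ?q) \<le> curvature_constant f g D"
    unfolding curvature_constant_def using assms(2-) by (intro Sup_upper) blast
  also have "\<dots> = ereal ?C"
    using assms(1) by (simp add: ereal_real)
  finally have "2 / l\<^sup>2 * ?q \<le> ?C"
    by simp
  then have "l\<^sup>2 / 2 * (2 / l\<^sup>2 * ?q) \<le> l\<^sup>2 / 2 * ?C"
    by (intro mult_left_mono) auto
  then show ?thesis
    using \<open>0 < l\<close> by simp
qed

section \<open>Balls inside the domain\<close>

text \<open>Strong convexity at \<open>l = 1/2\<close> gives the coefficient
  \<open>1/2 * 1/2 * \<alpha>/2 = \<alpha>/8\<close>, but only for unit vectors \<open>z\<close>,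
  hence only the sphere. Convexity fills in the ball, each point lying on a diameter.\<close>

lemma cball_subset_strongly_convex_set:
  fixes D :: "'a::euclidean_space set"
  assumes "strongly_convex_set \<alpha> D" "convex D" "x \<in> D" "y \<in> D" "\<alpha> > 0"
  shows "cball ((1/2) *\<^sub>R x + (1/2) *\<^sub>R y) (\<alpha> / 8 * (norm (x - y))\<^sup>2) \<subseteq> D"
proof
  let ?m = "(1/2) *\<^sub>R x + (1/2) *\<^sub>R y" and ?r = "\<alpha> / 8 * (norm (x - y))\<^sup>2"
  have sph: "?m + ?r *\<^sub>R z \<in> D" if "norm z = 1" for z :: 'a
  proof -
    have "(1/2) *\<^sub>R x + (1 - 1/2) *\<^sub>R y
        + ((1/2) * (1 - 1/2) * (\<alpha> / 2) * (norm (x - y))\<^sup>2) *\<^sub>R z \<in> D"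
      by (rule assms(1)[unfolded strongly_convex_set_def, rule_format]) (use assms(3,4) that in auto)
    then show ?thesis
      by simp
  qed
  fix w assume "w \<in> cball ?m ?r"
  then have w: "norm (w - ?m) \<le> ?r"
    by (simp add: dist_norm norm_minus_commute)
  show "w \<in> D"
  proof (cases "w = ?m")
    case True
    then show ?thesis
      using convexD[OF assms(2-4), of "1/2" "1/2"] by simp
  next
    case False
    define z where "z = (w - ?m) /\<^sub>R norm (w - ?m)"
    define t where "t = norm (w - ?m)"
    have "norm z = 1" "t > 0" "t \<le> ?r" and wz: "w = ?m + t *\<^sub>R z"
      using False w by (auto simp: z_def t_def)
    \<comment> \<open>The weight on the pole in direction \<open>z\<close>, solved from
      \<open>(2 * u - 1) * ?r = t\<close>; the antipodal pole gets \<open>1 - u\<close>.\<close>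
    define u where "u = (1 + t / ?r) / 2"
    have "0 \<le> u" "u \<le> 1" "?r > 0" and ut: "(2 * u - 1) * ?r = t"
      using \<open>t > 0\<close> \<open>t \<le> ?r\<close> by (auto simp: u_def divide_simps)
    have collinear: "u *\<^sub>R (m + r *\<^sub>R z) + (1 - u) *\<^sub>R (m + r *\<^sub>R (- z)) = m + ((2 * u - 1) * r) *\<^sub>R z"
      for m r
    proof -
      have "u *\<^sub>R (m + r *\<^sub>R z) + (1 - u) *\<^sub>R (m + r *\<^sub>R (- z))
          = (u + (1 - u)) *\<^sub>R m + (u * r - (1 - u) * r) *\<^sub>R z"
        by (simp only: scaleR_add_right scaleR_minus_right scaleR_scaleR
            scaleR_add_left[of u "1 - u" m] scaleR_diff_left[of "u * r" "(1 - u) * r" z])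
          (simp only: diff_conv_add_uminus add_ac)
      also have "u * r - (1 - u) * r = (2 * u - 1) * r"
        by (simp add: algebra_simps)
      finally show ?thesis
        by simp
    qed
    have "u *\<^sub>R (?m + ?r *\<^sub>R z) + (1 - u) *\<^sub>R (?m + ?r *\<^sub>R (- z)) \<in> D"
      using sph[of z] sph[of "- z"] \<open>norm z = 1\<close> \<open>0 \<le> u\<close> \<open>u \<le> 1\<close>
      by (intro convexD[OF assms(2)]) auto
    also have "u *\<^sub>R (?m + ?r *\<^sub>R z) + (1 - u) *\<^sub>R (?m + ?r *\<^sub>R (- z)) = ?m + ((2 * u - 1) * ?r) *\<^sub>R z"
      by (rule collinear)
    finally show ?thesis
      by (simp only: ut wz)
  qed
qed

text \<open>A ball is connected, so one that meets \<open>D\<close> and misses its frontier cannot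
  leave \<open>D\<close>.\<close>

lemma cball_subset_of_less_point_dist:
  fixes D :: "'a::euclidean_space set"
  assumes "x \<in> D" "ereal r < point_dist x (frontier D)"
  shows "cball x r \<subseteq> D"
proof (cases "r < 0")
  case False
  have "cball x r \<inter> frontier D = {}"
  proof (rule ccontr)
    assume "cball x r \<inter> frontier D \<noteq> {}"
    then obtain y where "y \<in> frontier D" "norm (x - y) \<le> r"
      by (auto simp: dist_norm)
    then have "point_dist x (frontier D) \<le> ereal r"
      unfolding point_dist_def by (meson INF_lower2 ereal_less_eq(3))
    then show False
      using assms(2) by simp
  qed
  moreover have "x \<in> cball x r \<inter> D"
    using assms(1) False by simp
  ultimately show ?thesis
    using connected_Int_frontier[of "cball x r" D] by (metis Diff_eq_empty_iff connected_cball empty_iff)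
qed auto

section \<open>The convergence rate along one sample path\<close>

text \<open>Describes the algorithm at one fixed outcome in \<open>N\<^sub>0\<close>. There the
  indicator equals 1 and is left out, so everything about the rate becomes deterministic.\<close>

definition frank_wolfe_path ::
    "('a::euclidean_space \<Rightarrow> 'a) \<Rightarrow> 'a set \<Rightarrow> (nat \<Rightarrow> 'a set) \<Rightarrow> (nat \<Rightarrow> 'a) \<Rightarrow> (nat \<Rightarrow> 'a) \<Rightarrow> bool" where
  "frank_wolfe_path g D K s x \<longleftrightarrow>
     x 0 \<in> D \<and> (\<forall>n\<ge>1. K n \<in> convex_bodies \<and> K n \<subseteq> D) \<and>
     (\<forall>n. is_arg_min (\<lambda>y. y \<bullet> g (x n)) (\<lambda>y. y \<in> K (Suc n)) (s (Suc n))) \<and>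
     (\<forall>n. x (Suc n) = x n + step_size n *\<^sub>R (s (Suc n) - x n))"

lemma frank_wolfe_path_in:
  assumes "frank_wolfe_path g D K s x" "convex D"
  shows "x n \<in> D" "s (Suc n) \<in> D"
proof -
  show s: "s (Suc n) \<in> D" for n
    using assms(1) by (force simp: frank_wolfe_path_def is_arg_min_def)
  show "x n \<in> D"
  proof (induction n)
    case 0
    then show ?case
      using assms(1) by (simp add: frank_wolfe_path_def)
  next
    case (Suc n)
    have "(1 - step_size n) *\<^sub>R x n + step_size n *\<^sub>R s (Suc n) \<in> D"
      using step_size_bounds[of n] by (intro convexD[OF assms(2) Suc s]) auto
    also have "(1 - step_size n) *\<^sub>R x n + step_size n *\<^sub>R s (Suc n) = x (Suc n)"
    proof -
      have "x (Suc n) = x n + step_size n *\<^sub>R (s (Suc n) - x n)"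
        using assms(1) unfolding frank_wolfe_path_def by blast
      then show ?thesis
        by (simp add: scaleR_diff_left scaleR_diff_right)
    qed
    finally show ?case .
  qed
qed

text \<open>\<open>N\<close> and \<open>B\<close> are quantified before \<open>K\<close>,
  \<open>s\<close> and \<open>x\<close>: they have to serve all paths at once, so that later they do
  not depend on the outcome.\<close>

lemma frank_wolfe_path_rate:
  fixes D :: "'a::euclidean_space set"
  assumes D: "D \<in> convex_bodies" and f: "continuous_on D f"
    and "\<mu> > 0" and sc: "strongly_convex_fun_on \<mu> D f g"
    and cc: "\<bar>curvature_constant f g D\<bar> \<noteq> \<infinity>"
    and xs: "xs \<in> D" "\<And>y. y \<in> D \<Longrightarrow> f xs \<le> f y"
    and r: "cball xs r \<subseteq> D" "0 \<le> \<eta>" "\<eta> < r" and e: "e \<longlonglongrightarrow> 0"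
  shows "\<exists>N\<ge>1. \<exists>B\<ge>0. \<forall>K s x. frank_wolfe_path g D K s x \<longrightarrow>
    (\<forall>n\<ge>1. hausdorff_dist (K (Suc n)) D \<le> e n + \<eta>) \<longrightarrow>
    (\<forall>n\<ge>N. f (x n) - f xs \<le> B * (step_size (n - 1))\<^sup>2)"
proof -
  \<comment> \<open>Half of the margin \<open>r - \<eta>\<close>: once
    \<open>e n < \<kappa>\<close>, the other half remains as a lower bound for
    \<open>r - (e n + \<eta>)\<close>.\<close>
  define \<kappa> where "\<kappa> = (r - \<eta>) / 2"
  have "\<kappa> > 0"
    using r by (simp add: \<kappa>_def)
  then have "eventually (\<lambda>n. e n < \<kappa>) sequentially"
    using e by (rule order_tendstoD(2)[rotated])
  then obtain N0 where N0: "\<And>n. n \<ge> N0 \<Longrightarrow> e n < \<kappa>"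
    by (auto simp: eventually_sequentially)
  \<comment> \<open>The Hausdorff bound is available only from index 1 on, hence the
    maximum.\<close>
  define N where "N = max 1 N0"
  define a where "a = \<kappa> * sqrt (2 * \<mu>)"
  define C where "C = max 0 (real_of_ereal (curvature_constant f g D))"
  have "a > 0" "C \<ge> 0"
    using \<open>\<kappa> > 0\<close> \<open>\<mu> > 0\<close> by (auto simp: a_def C_def)
  have "bdd_above (f ` D)"
    using D f by (auto simp: convex_bodies_def
        intro!: bounded_imp_bdd_above compact_imp_bounded compact_continuous_image)
  then obtain b where b: "\<And>y. y \<in> D \<Longrightarrow> f y \<le> b"
    by (auto simp: bdd_above_def)
  \<comment> \<open>The first argument is what the scalar recursion demands. The second secures its
    base case at \<open>N\<close> for every path, since \<open>f\<close> is at most \<open>b\<close>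
    on \<open>D\<close>.\<close>
  define B where "B = max (C\<^sup>2 / (4 * a\<^sup>2) + C / 2) ((b - f xs) / (step_size (N - 1))\<^sup>2)"
  have "B \<ge> 0"
    using \<open>C \<ge> 0\<close> by (simp add: B_def le_max_iff_disj)
  have "f (x n) - f xs \<le> B * (step_size (n - 1))\<^sup>2"
    if path: "frank_wolfe_path g D K s x"
      and hd: "\<forall>n\<ge>1. hausdorff_dist (K (Suc n)) D \<le> e n + \<eta>" and "n \<ge> N" for K s x n
  proof (rule step_size_recursion_bound[where m = N and a = a and C = C])
    have x: "x n \<in> D" and s: "s (Suc n) \<in> D" for n
      using frank_wolfe_path_in[OF path] D by (auto simp: convex_bodies_def)
    show "0 \<le> f (x n) - f xs" for n
      using xs x by simp
    show "f (x N) - f xs \<le> B * (step_size (N - 1))\<^sup>2"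
    proof -
      have "f (x N) - f xs \<le> (b - f xs) / (step_size (N - 1))\<^sup>2 * (step_size (N - 1))\<^sup>2"
        using b x step_size_bounds(1)[of "N - 1"] by simp
      also have "\<dots> \<le> B * (step_size (N - 1))\<^sup>2"
        by (intro mult_right_mono) (auto simp: B_def)
      finally show ?thesis .
    qed
    fix n assume n: "N \<le> n"
    let ?l = "step_size n" and ?h = "f (x n) - f xs" and ?G = "norm (g (x n))"
    have "s (Suc n) \<bullet> g (x n) \<le> xs \<bullet> g (x n) - (r - (e n + \<eta>)) * ?G"
      using path hd n D r
      by (intro linear_minimum_hausdorff_le[where K = "K (Suc n)"])
        (auto simp: frank_wolfe_path_def N_def)
    moreover have "\<kappa> * ?G \<le> (r - (e n + \<eta>)) * ?G"
      using N0[of n] n by (intro mult_right_mono) (auto simp: \<kappa>_def N_def field_simps)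
    moreover have "\<kappa> * sqrt (2 * \<mu> * ?h) \<le> \<kappa> * ?G"
      using strongly_convex_fun_gap_le(2)[OF sc x xs(1) \<open>\<mu> > 0\<close>] \<open>\<kappa> > 0\<close> by simp
    moreover have "?h \<le> (x n - xs) \<bullet> g (x n)"
      by (rule strongly_convex_fun_gap_le(1)[OF sc x xs(1) \<open>\<mu> > 0\<close>])
    \<comment> \<open>Split \<open>s (Suc n) - x n\<close> at \<open>xs\<close>: the part from
      \<open>xs\<close> to \<open>s (Suc n)\<close> yields the square-root gain, the part from
      \<open>x n\<close> to \<open>xs\<close> yields \<open>- ?h\<close>.\<close>
    ultimately have "(s (Suc n) - x n) \<bullet> g (x n) \<le> - ?h - a * sqrt ?h"
      by (simp add: inner_diff_left a_def real_sqrt_mult)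
    then have "?l * ((s (Suc n) - x n) \<bullet> g (x n)) \<le> ?l * (- ?h - a * sqrt ?h)"
      using step_size_bounds[of n] by (intro mult_left_mono) auto
    moreover have "f (x (Suc n)) \<le> f (x n) + ?l * ((s (Suc n) - x n) \<bullet> g (x n))
        + ?l\<^sup>2 * real_of_ereal (curvature_constant f g D) / 2"
      using curvature_constant_bound[OF cc x s step_size_bounds] path
      by (simp add: frank_wolfe_path_def)
    moreover have "?l\<^sup>2 * real_of_ereal (curvature_constant f g D) \<le> ?l\<^sup>2 * C"
      by (intro mult_left_mono) (auto simp: C_def)
    ultimately show "f (x (Suc n)) - f xs \<le> (1 - ?l) * ?h - ?l * a * sqrt ?h + ?l\<^sup>2 * C / 2"
      by (simp add: algebra_simps)
  qed (use \<open>a > 0\<close> \<open>C \<ge> 0\<close> \<open>n \<ge> N\<close> in \<open>auto simp: B_def N_def\<close>)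
  with \<open>B \<ge> 0\<close> show ?thesis
    by (intro exI[of _ N] exI[of _ B] conjI) (auto simp: N_def)
qed

text \<open>If \<open>D\<close> is a singleton, every path is constant. Otherwise the ball around
  the midpoint of \<open>xs\<close> and a second point gives \<open>D\<close> nonempty interior, so
  its relative frontier is its frontier, and the distance hypothesis provides a ball around
  \<open>xs\<close>.\<close>

lemma frank_wolfe_path_rate_strongly_convex_set:
  fixes D :: "'a::euclidean_space set"
  assumes D: "D \<in> convex_bodies" and f: "continuous_on D f"
    and "\<mu> > 0" and sc: "strongly_convex_fun_on \<mu> D f g"
    and "\<alpha> > 0" and scD: "strongly_convex_set \<alpha> D"
    and cc: "\<bar>curvature_constant f g D\<bar> \<noteq> \<infinity>"
    and xs: "xs \<in> rel_interior D" "\<forall>y\<in>D. f xs \<le> f y"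
    and "0 \<le> \<eta>" and \<eta>: "ereal \<eta> < point_dist xs (rel_frontier D)" and e: "e \<longlonglongrightarrow> 0"
  shows "\<exists>N\<ge>1. \<exists>B\<ge>0. \<forall>K s x. frank_wolfe_path g D K s x \<longrightarrow>
    (\<forall>n\<ge>1. hausdorff_dist (K (Suc n)) D \<le> e n + \<eta>) \<longrightarrow>
    (\<forall>n\<ge>N. f (x n) - f xs \<le> B * (step_size (n - 1))\<^sup>2)"
proof (cases "D = {xs}")
  case True
  then have "f (x n) - f xs \<le> 0 * (step_size (n - 1))\<^sup>2" if "frank_wolfe_path g D K s x" for K s x n
    using frank_wolfe_path_in(1)[OF that, of n] by simp
  then show ?thesis
    by (intro exI[of _ "1::nat"] exI[of _ "0::real"]) auto
next
  case False
  have xD: "xs \<in> D"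
    using xs(1) rel_interior_subset by blast
  then obtain y where y: "y \<in> D" "y \<noteq> xs"
    using False by blast
  have "cball ((1/2) *\<^sub>R xs + (1/2) *\<^sub>R y) (\<alpha> / 8 * (norm (xs - y))\<^sup>2) \<subseteq> D"
    using scD D xD y \<open>\<alpha> > 0\<close> by (intro cball_subset_strongly_convex_set) (auto simp: convex_bodies_def)
  moreover have "\<alpha> / 8 * (norm (xs - y))\<^sup>2 > 0"
    using y \<open>\<alpha> > 0\<close> by simp
  ultimately have "(1/2) *\<^sub>R xs + (1/2) *\<^sub>R y \<in> interior D"
    unfolding mem_interior_cball by (intro exI conjI)
  then have "interior D \<noteq> {}"
    by blast
  then have "rel_frontier D = frontier D"
    by (rule rel_frontier_nonempty_interior)
  moreover obtain r where "ereal \<eta> < ereal r" "ereal r < point_dist xs (rel_frontier D)"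
    using \<eta> ereal_dense2 by blast
  ultimately have "cball xs r \<subseteq> D" "\<eta> < r"
    using cball_subset_of_less_point_dist[OF xD] by auto
  then show ?thesis
    using assms xD by (intro frank_wolfe_path_rate) auto
qed

section \<open>From single paths to probabilities\<close>

theorem theorem4:
  fixes M :: "'w measure"
    and domf D :: "'a::euclidean_space set"
    and f :: "'a \<Rightarrow> real" and g :: "'a \<Rightarrow> 'a" and xstar :: 'a
    and Dn :: "nat \<Rightarrow> 'w \<Rightarrow> 'a set" and S X :: "nat \<Rightarrow> 'w \<Rightarrow> 'a"
    and \<mu> \<alpha> \<beta>1 \<delta> r1 c1 \<eta>1 :: real
  assumes "prob_space M" and "complete_measure M"
    and "closed domf" and "convex_on domf f" and "has_continuous_gradient_on f g domf"
    and "D \<subseteq> domf" and "D \<noteq> {}" and "compact D" and "convex D"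
    and "\<mu> > 0" and "strongly_convex_fun_on \<mu> D f g"
    and "\<alpha> > 0" and "strongly_convex_set \<alpha> D"
    and "\<And>x. is_arg_min f (\<lambda>y. y \<in> D) x \<longleftrightarrow> x = xstar"
    and "xstar \<in> rel_interior D"
    and "\<bar>curvature_constant f g D\<bar> \<noteq> \<infinity>"
    and "frank_wolfe_known_objective M g D Dn S X"
    and "\<beta>1 \<in> {0..1}" and "\<delta> \<in> {0..1}" and "r1 \<in> {0<..1}" and "c1 > 0" and "\<eta>1 \<ge> 0"
    and "ereal (3 * \<eta>1) < point_dist xstar (rel_frontier D)"
    and "measure M {\<omega> \<in> space M. \<forall>n\<ge>1.
           hausdorff_dist (Dn (Suc n) \<omega>) D \<le> c1 * step_size n powr r1 + \<eta>1} \<ge> 1 - \<beta>1"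
    and "measure M (inner_approximation_event M D Dn) \<ge> 1 - \<delta>"
  defines "p \<equiv> measure M {\<omega> \<in> space M. \<exists>n\<ge>1. X n \<omega> \<in> domf \<and> g (X n \<omega>) = 0}"
  shows "\<exists>N\<ge>1. \<exists>B\<ge>0.
    measure M {\<omega> \<in> space M. \<forall>n\<ge>N. X n \<omega> \<in> domf \<and>
      0 \<le> f (X n \<omega>) - min_value f D \<and>
      f (X n \<omega>) - min_value f D
        \<le> B * step_size (n - 1) powr (2 * r1) + 3 / 2 * \<eta>1 * max_gradient_norm g D}
    \<ge> 1 - (\<beta>1 + \<delta> + p)"
proof -
  interpret prob_space M by fact
  have D: "D \<in> convex_bodies"
    using \<open>D \<noteq> {}\<close> \<open>compact D\<close> \<open>convex D\<close> by (simp add: convex_bodies_def)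
  have contf: "continuous_on domf f"
    using \<open>has_continuous_gradient_on f g domf\<close>
    by (auto simp: has_continuous_gradient_on_def continuous_on_eq_continuous_within
        intro: has_derivative_continuous)
  have contf_D: "continuous_on D f"
    using contf \<open>D \<subseteq> domf\<close> continuous_on_subset by blast
  have xs: "xstar \<in> D" "\<forall>y\<in>D. f xstar \<le> f y"
    using assms(14)[of xstar] by (auto simp: is_arg_min_linorder)
  have min_value: "min_value f D = f xstar"
    unfolding min_value_def using xs by (intro cInf_eq_minimum) auto
  have "bdd_above ((\<lambda>x. norm (g x)) ` D)"
    using \<open>has_continuous_gradient_on f g domf\<close> \<open>D \<subseteq> domf\<close> \<open>compact D\<close>
    by (auto simp: has_continuous_gradient_on_def intro!: bounded_imp_bdd_above compact_imp_bounded
        compact_continuous_image continuous_intros intro: continuous_on_subset)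
  then have L0: "0 \<le> max_gradient_norm g D"
    unfolding max_gradient_norm_def using xs(1) by (intro cSUP_upper2[of _ _ xstar]) auto
  have e0: "(\<lambda>n. c1 * step_size n powr r1) \<longlonglongrightarrow> 0"
    using tendsto_mult_left[OF tendsto_zero_powrI[OF step_size_tendsto_0 tendsto_const], of r1 c1]
      \<open>r1 \<in> {0<..1}\<close> step_size_bounds by (simp add: less_imp_le)
  have "ereal \<eta>1 < point_dist xstar (rel_frontier D)"
    using \<open>\<eta>1 \<ge> 0\<close> \<open>ereal (3 * \<eta>1) < point_dist xstar (rel_frontier D)\<close>
    by (elim le_less_trans[rotated]) simp
  \<comment> \<open>The constants are fixed here, before any outcome is chosen.\<close>
  from frank_wolfe_path_rate_strongly_convex_set[OF D contf_D assms(10-13,16,15) xs(2) \<open>\<eta>1 \<ge> 0\<close> this e0]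
  obtain N B where "N \<ge> 1" "B \<ge> 0"
    and "\<forall>K s x. frank_wolfe_path g D K s x \<longrightarrow>
      (\<forall>n\<ge>1. hausdorff_dist (K (Suc n)) D \<le> c1 * step_size n powr r1 + \<eta>1) \<longrightarrow>
      (\<forall>n\<ge>N. f (x n) - f xstar \<le> B * (step_size (n - 1))\<^sup>2)"
    by (elim exE conjE)
  note rate = this(3)[rule_format]
  define E0 where "E0 = {\<omega> \<in> space M. X 0 \<omega> \<in> D}"
  define E1 where "E1 = {\<omega> \<in> space M. \<forall>n\<ge>1.
           hausdorff_dist (Dn (Suc n) \<omega>) D \<le> c1 * step_size n powr r1 + \<eta>1}"
  define E2 where "E2 = inner_approximation_event M D Dn"
  define bound where "bound n = B * step_size (n - 1) powr (2 * r1)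
    + 3 / 2 * \<eta>1 * max_gradient_norm g D" for n
  define F where "F = {\<omega> \<in> space M. \<forall>n\<ge>N. X n \<omega> \<in> domf \<and>
      0 \<le> f (X n \<omega>) - min_value f D \<and> f (X n \<omega>) - min_value f D \<le> bound n}"
  note fw = \<open>frank_wolfe_known_objective M g D Dn S X\<close>[unfolded frank_wolfe_known_objective_def Let_def]
  have Dn: "Dn n \<omega> \<in> convex_bodies" if "n \<ge> 1" "\<omega> \<in> space M" for n \<omega>
  proof -
    have "Dn n \<in> measurable M hausdorff_borel"
      using fw that(1) by (simp add: domain_approximation_process_def)
    from measurable_space[OF this that(2)] show ?thesis
      by (simp add: hausdorff_borel_def space_measure_of_conv)
  qed
  have X: "X n \<in> borel_measurable M" for n
  proof (induction n)
    case 0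
    then show ?case
      using fw by simp
  next
    case (Suc n)
    have "S (Suc n) \<in> borel_measurable M"
      using fw by simp
    with Suc have "(\<lambda>\<omega>. X n \<omega> + step_size n *\<^sub>R (S (Suc n) \<omega> - X n \<omega>)) \<in> borel_measurable M"
      by measurable
    then show ?case
      by (rule measurable_cong[THEN iffD1, rotated]) (use fw in simp)
  qed
  have sub: "E0 \<inter> E1 \<inter> E2 \<subseteq> F"
  proof
    fix \<omega> assume \<omega>: "\<omega> \<in> E0 \<inter> E1 \<inter> E2"
    then have sp: "\<omega> \<in> space M"
      by (simp add: E0_def)
    have path: "frank_wolfe_path g D (\<lambda>n. Dn n \<omega>) (\<lambda>n. S n \<omega>) (\<lambda>n. X n \<omega>)"
      unfolding frank_wolfe_path_def
    proof (intro conjI allI impI)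
      show "Dn n \<omega> \<subseteq> D" if "n \<ge> 1" for n
        using \<omega> that by (auto simp: E2_def inner_approximation_event_def)
      \<comment> \<open>With indicator 1 the selection minimizes the true linear objective.\<close>
      have "indicator (inner_approximation_event M D Dn \<inter> {\<omega> \<in> space M. X 0 \<omega> \<in> D}) \<omega> = (1::real)"
        using \<omega> by (simp add: E0_def E2_def)
      then show "is_arg_min (\<lambda>y. y \<bullet> g (X n \<omega>)) (\<lambda>y. y \<in> Dn (Suc n) \<omega>) (S (Suc n) \<omega>)" for n
        using fw sp by (auto dest!: spec[of _ n] bspec[of "space M" _ \<omega>])
    qed (use \<omega> sp Dn fw in \<open>auto simp: E0_def\<close>)
    have "X n \<omega> \<in> domf \<and> 0 \<le> f (X n \<omega>) - min_value f D \<and> f (X n \<omega>) - min_value f D \<le> bound n"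
      if "n \<ge> N" for n
    proof (intro conjI)
      have XD: "X n \<omega> \<in> D"
        by (rule frank_wolfe_path_in(1)[OF path \<open>convex D\<close>])
      then show "X n \<omega> \<in> domf" "0 \<le> f (X n \<omega>) - min_value f D"
        using \<open>D \<subseteq> domf\<close> xs by (auto simp: min_value)
      have "f (X n \<omega>) - f xstar \<le> B * (step_size (n - 1))\<^sup>2"
        using \<omega> that by (intro rate[OF path]) (auto simp: E1_def)
      also have "(step_size (n - 1))\<^sup>2 = step_size (n - 1) powr 2"
        by (rule powr_numeral[OF less_imp_le[OF step_size_bounds(1)], symmetric])
      \<comment> \<open>The base is at most 1, so lowering the exponent from 2 to
        \<open>2 * r1\<close> can only increase the power.\<close>
      also have "\<dots> \<le> step_size (n - 1) powr (2 * r1)"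
        using step_size_bounds[of "n - 1"] \<open>r1 \<in> {0<..1}\<close> by (intro powr_mono') auto
      finally have "f (X n \<omega>) - f xstar \<le> B * step_size (n - 1) powr (2 * r1)"
        using \<open>B \<ge> 0\<close> by (simp add: mult_left_mono)
      also have "\<dots> \<le> bound n"
        using \<open>\<eta>1 \<ge> 0\<close> L0 by (simp add: bound_def)
      finally show "f (X n \<omega>) - min_value f D \<le> bound n"
        by (simp add: min_value)
    qed
    then show "\<omega> \<in> F"
      using sp by (simp add: F_def)
  qed
  have "F \<in> events"
  proof -
    \<comment> \<open>\<open>f\<close> is controlled only on \<open>domf\<close>. Its extension by 0
      off this closed set is Borel measurable, and the conjunct
      \<open>X n \<omega> \<in> domf\<close> in \<open>F\<close> makes the exchange
      harmless.\<close>
    let ?fi = "\<lambda>x. indicator domf x *\<^sub>R f x"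
    have fi: "?fi \<in> borel_measurable borel"
      using contf \<open>closed domf\<close> by (intro borel_measurable_continuous_on_indicator) auto
    have "F = {\<omega> \<in> space M. \<forall>n\<ge>N. X n \<omega> \<in> domf \<and>
      0 \<le> ?fi (X n \<omega>) - min_value f D \<and> ?fi (X n \<omega>) - min_value f D \<le> bound n}"
      unfolding F_def by (intro Collect_cong conj_cong all_cong) auto
    also have "\<dots> \<in> events"
    proof (intro sets.sets_Collect_countable_All sets.sets_Collect_imp sets.sets_Collect_conj
        sets.sets_Collect_const)
      fix n
      have "(\<lambda>\<omega>. ?fi (X n \<omega>)) \<in> borel_measurable M"
        by (rule measurable_compose[OF X fi])
      show "{\<omega> \<in> space M. X n \<omega> \<in> domf} \<in> events"
        using measurable_sets[OF X[of n] borel_closed[OF \<open>closed domf\<close>]]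
        by (simp add: vimage_def Int_def conj_commute)
      show "{\<omega> \<in> space M. 0 \<le> ?fi (X n \<omega>) - min_value f D} \<in> events"
        "{\<omega> \<in> space M. ?fi (X n \<omega>) - min_value f D \<le> bound n} \<in> events"
        by (intro borel_measurable_le borel_measurable_diff borel_measurable_const; fact)+
    qed
    finally show ?thesis .
  qed
  have E0: "E0 \<in> events"
    unfolding E0_def
    using measurable_sets[OF X[of 0] borel_closed[OF compact_imp_closed[OF \<open>compact D\<close>]]]
    by (simp add: vimage_def Int_def conj_commute)
  moreover have "AE \<omega> in M. \<omega> \<in> E0"
    using fw by (auto simp: E0_def)
  ultimately have prob_E0: "prob E0 = 1"
    by (simp add: prob_eq_1)
  have "p \<ge> 0"
    by (simp add: p_def)
  have "prob F \<ge> 1 - (\<beta>1 + \<delta> + p)"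
    \<comment> \<open>A non-measurable event has measure \<open>0\<close>, which forces \<open>\<beta>1 = 1\<close> or \<open>\<delta> = 1\<close>.\<close>
  proof (cases "E1 \<in> events \<and> E2 \<in> events")
    case False
    then have "prob E1 = 0 \<or> prob E2 = 0"
      by (auto simp: measure_notin_sets)
    then have "\<beta>1 + \<delta> \<ge> 1"
      using assms(18,19,24,25) by (auto simp: E1_def E2_def)
    then show ?thesis
      using \<open>p \<ge> 0\<close> measure_nonneg[of M F] by linarith
  next
    case True
    have "1 - (\<beta>1 + \<delta>) \<le> prob E1 + prob E2 - 1"
      using assms(24,25) by (simp add: E1_def E2_def)
    \<comment> \<open>Inclusion-exclusion together with
      \<open>prob (E1 \<union> E2) \<le> 1\<close>.\<close>
    also have "\<dots> \<le> prob (E1 \<inter> E2)"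
      using True finite_measure_Union'[of E1 E2] finite_measure_Diff'[of E2 E1] prob_le_1[of "E1 \<union> E2"]
      by (simp add: Int_commute)
    \<comment> \<open>\<open>E0\<close> has full measure, so intersecting with it costs
      nothing.\<close>
    also have "\<dots> = prob (E0 \<inter> E1 \<inter> E2)"
      using True E0 \<open>AE \<omega> in M. \<omega> \<in> E0\<close> by (intro finite_measure_eq_AE) auto
    also have "\<dots> \<le> prob F"
      using sub \<open>F \<in> events\<close> by (rule finite_measure_mono)
    finally show ?thesis
      using \<open>p \<ge> 0\<close> by simp
  qed
  then show ?thesis
    unfolding F_def bound_def using \<open>N \<ge> 1\<close> \<open>B \<ge> 0\<close> by (intro exI conjI)
qed

end
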